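(* Let $\mathcal{T}$ be an $l$-eligible microdata table. The three-phase algorithm described in the context (with arbitrary tie-breaking) terminates with remaining groups $\hat{Q}_1,\dots,\hat{Q}_s$ and residue set $\hat{R}$ forming a feasible solution of the reformulated tuple minimization problem with $|\hat{R}| \le l\cdot OPT$; i.e., it is an $l$-approximation algorithm for tuple minimization.
   Context: A microdata table $\mathcal{T}$ is a multiset of $n$ tuples with values on $d$ quasi-identifier (QI) attributes and one sensitive attribute (SA). For a multiset $Q$ and SA value $v$, $h(Q,v)$ is the number of tuples in $Q$ with SA value $v$, $h(Q)=\max_v h(Q,v)$, pillars of $Q$ are the $v$ with $h(Q,v)=h(Q)$; $Q$ is $l$-eligible if $|Q|\ge l\cdot h(Q)$. Let $Q_1,\dots,Q_s$ be the maximal classes of tuples of $\mathcal{T}$ with identical values on all QI attributes. Reformulated tuple minimization: choose sub-multisets $Q'_i\subseteq Q_i$ and $R'=\mathcal{T}\setminus\bigcup_i Q'_i$ with all $Q'_i$ and $R'$ $l$-eligible, minimizing $|R'|$ (the tuples of $R'$ are the suppressed ones); $OPT$ is the minimum. The algorithm only moves tuples from the groups into a residue set $R$ (initially empty), and terminates as soon as $R$ becomes $l$-eligible. Terminology (w.r.t. current state): a group $Q$ is thin if $|Q|=l\cdot h(Q)$, fat if $|Q|\ge l\cdot h(Q)+1$; conflicting if some pillar of $Q$ is a pillar of $R$ (its conflicting pillars, set $C(Q)$); dead if thin and conflicting, alive otherwise; an SA value $v$ is alive if some alive group $Q$ has $h(Q,v)>0$. Phase One: for each $i$, while $Q_i$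 is not $l$-eligible, move a tuple of a pillar of $Q_i$ to $R$. Phase Two: repeat: if no SA value is alive, go to Phase Three; else pick an alive SA value $v$ minimizing $h(R,v)$ and an alive group $Q$ with $h(Q,v)>0$; if $Q$ is fat move one tuple with SA value $v$ to $R$, if thin move one tuple of each pillar of $Q$ to $R$. Phase Three proceeds in rounds. Step 1: let $P$ be the set of pillars of $R$ and $S=\emptyset$; while $P\ne\emptyset$, pick a group $Q$ minimizing $|C(Q)\cap P|$, add it to $S$, and set $P\leftarrow P\cap C(Q)$; then for each $Q\in S$ move one tuple of each pillar of $Q$ to $R$. Step 2: for each group $Q$ that is now alive, repeat until $Q$ is dead: if $Q$ is fat, move to $R$ a tuple of $Q$ whose SA value is not a pillar of $R$; if $Q$ is thin and non-conflicting, move one tuple of each pillar of $Q$ to $R$. All ties are broken arbitrarily. *)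

theory Defs
  imports "HOL-Library.Multiset"
begin

text \<open>Tuples are pairs (QI value, SA value); the QI vector is abstracted by the type 'q.
  A table is a multiset of tuples.\<close>

definition hcnt :: "('q \<times> 'v) multiset \<Rightarrow> 'v \<Rightarrow> nat" where
  "hcnt Q v = count (image_mset snd Q) v"

definition hmax :: "('q \<times> 'v) multiset \<Rightarrow> nat" where
  "hmax Q = Max (insert 0 (hcnt Q ` set_mset (image_mset snd Q)))"

definition pillars :: "('q \<times> 'v) multiset \<Rightarrow> 'v set" where
  "pillars Q = {v. v \<in># image_mset snd Q \<and> hcnt Q v = hmax Q}"

definition l_eligible :: "nat \<Rightarrow> ('q \<times> 'v) multiset \<Rightarrow> bool" where
  "l_eligible l Q \<longleftrightarrow> l * hmax Q \<le> size Q"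

definition thin :: "nat \<Rightarrow> ('q \<times> 'v) multiset \<Rightarrow> bool" where
  "thin l Q \<longleftrightarrow> size Q = l * hmax Q"

definition fat :: "nat \<Rightarrow> ('q \<times> 'v) multiset \<Rightarrow> bool" where
  "fat l Q \<longleftrightarrow> l * hmax Q + 1 \<le> size Q"

definition cpill :: "('q \<times> 'v) multiset \<Rightarrow> ('q \<times> 'v) multiset \<Rightarrow> 'v set" where
  "cpill Q R = pillars Q \<inter> pillars R"

definition conflicting :: "('q \<times> 'v) multiset \<Rightarrow> ('q \<times> 'v) multiset \<Rightarrow> bool" where
  "conflicting Q R \<longleftrightarrow> cpill Q R \<noteq> {}"

definition dead :: "nat \<Rightarrow> ('q \<times> 'v) multiset \<Rightarrow> ('q \<times> 'v) multiset \<Rightarrow> bool" where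
  "dead l Q R \<longleftrightarrow> thin l Q \<and> conflicting Q R"

text \<open>Convention: empty groups (all tuples removed) are no longer treated as groups,
  in particular they are never alive.\<close>
definition alive_group :: "nat \<Rightarrow> ('q \<times> 'v) multiset \<Rightarrow> ('q \<times> 'v) multiset \<Rightarrow> bool" where
  "alive_group l Q R \<longleftrightarrow> Q \<noteq> {#} \<and> \<not> dead l Q R"

definition alive_value :: "nat \<Rightarrow> ('q \<Rightarrow> ('q \<times> 'v) multiset) \<Rightarrow> ('q \<times> 'v) multiset \<Rightarrow> 'v \<Rightarrow> bool" where
  "alive_value l G R v \<longleftrightarrow> (\<exists>q. alive_group l (G q) R \<and> 0 < hcnt (G q) v)"

text \<open>One tuple of each pillar of a group (all tuples of a group share the QI value).\<close>
definition batch :: "('q \<times> 'v) multiset \<Rightarrow> ('q \<times> 'v) multiset" where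
  "batch Q = mset_set {t. t \<in># Q \<and> snd t \<in> pillars Q}"

definition cls :: "('q \<times> 'v) multiset \<Rightarrow> 'q \<Rightarrow> ('q \<times> 'v) multiset" where
  "cls T q = filter_mset (\<lambda>t. fst t = q) T"

definition feasible :: "nat \<Rightarrow> ('q \<times> 'v) multiset \<Rightarrow> ('q \<Rightarrow> ('q \<times> 'v) multiset)
    \<Rightarrow> ('q \<times> 'v) multiset \<Rightarrow> bool" where
  "feasible l T Qs R' \<longleftrightarrow>
     (\<forall>q. Qs q \<subseteq># cls T q) \<and> (\<forall>q. l_eligible l (Qs q)) \<and> l_eligible l R' \<and>
     R' = T - (\<Sum>q\<in>fst ` set_mset T. Qs q)"

definition OPT :: "nat \<Rightarrow> ('q \<times> 'v) multiset \<Rightarrow> nat" where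
  "OPT l T = (LEAST k. \<exists>Qs R'. feasible l T Qs R' \<and> size R' = k)"

text \<open>Control states of the algorithm.
  P1: Phase One; P2: Phase Two;
  P3S1 P S: Phase Three step 1, building S;
  P3Mv S: Phase Three step 1, moving pillars of the groups in S;
  P3S2 A: Phase Three step 2, groups of A (alive at the start of step 2) still to process;
  P3Loop q A: Phase Three step 2, currently processing group q.\<close>
datatype ('q, 'v) phase =
    P1 | P2 | P3S1 "'v set" "'q set" | P3Mv "'q set" | P3S2 "'q set" | P3Loop 'q "'q set" | Done

type_synonym ('q, 'v) state =
  "('q, 'v) phase \<times> ('q \<Rightarrow> ('q \<times> 'v) multiset) \<times> ('q \<times> 'v) multiset"

definition chk :: "nat \<Rightarrow> ('q \<times> 'v) multiset \<Rightarrow> ('q, 'v) phase \<Rightarrow> ('q, 'v) phase" where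
  "chk l R ph = (if l_eligible l R then Done else ph)"

definition alg_init :: "('q \<times> 'v) multiset \<Rightarrow> ('q, 'v) state" where
  "alg_init T = (P1, cls T, {#})"

inductive alg_step :: "nat \<Rightarrow> ('q, 'v) state \<Rightarrow> ('q, 'v) state \<Rightarrow> bool" for l where
  p1_move: "\<not> l_eligible l (G q) \<Longrightarrow> t \<in># G q \<Longrightarrow> snd t \<in> pillars (G q) \<Longrightarrow>
    alg_step l (P1, G, R) (P1, G(q := G q - {#t#}), R + {#t#})"
| p1_end: "(\<forall>q. l_eligible l (G q)) \<Longrightarrow> alg_step l (P1, G, R) (chk l R P2, G, R)"
| p2_end: "\<not> (\<exists>v. alive_value l G R v) \<Longrightarrow>
    alg_step l (P2, G, R) (P3S1 (pillars R) {}, G, R)"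
| p2_fat: "alive_value l G R v \<Longrightarrow> (\<forall>w. alive_value l G R w \<longrightarrow> hcnt R v \<le> hcnt R w) \<Longrightarrow>
    alive_group l (G q) R \<Longrightarrow> 0 < hcnt (G q) v \<Longrightarrow> fat l (G q) \<Longrightarrow>
    t \<in># G q \<Longrightarrow> snd t = v \<Longrightarrow>
    alg_step l (P2, G, R) (chk l (R + {#t#}) P2, G(q := G q - {#t#}), R + {#t#})"
| p2_thin: "alive_value l G R v \<Longrightarrow> (\<forall>w. alive_value l G R w \<longrightarrow> hcnt R v \<le> hcnt R w) \<Longrightarrow>
    alive_group l (G q) R \<Longrightarrow> 0 < hcnt (G q) v \<Longrightarrow> thin l (G q) \<Longrightarrow>
    alg_step l (P2, G, R)
      (chk l (R + batch (G q)) P2, G(q := G q - batch (G q)), R + batch (G q))"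
| p3_pick: "P \<noteq> {} \<Longrightarrow> G q \<noteq> {#} \<Longrightarrow>
    (\<forall>q'. G q' \<noteq> {#} \<longrightarrow> card (cpill (G q) R \<inter> P) \<le> card (cpill (G q') R \<inter> P)) \<Longrightarrow>
    alg_step l (P3S1 P S, G, R) (P3S1 (P \<inter> cpill (G q) R) (insert q S), G, R)"
| p3_s1_end: "alg_step l (P3S1 {} S, G, R) (P3Mv S, G, R)"
| p3_mv: "q \<in> S \<Longrightarrow>
    alg_step l (P3Mv S, G, R)
      (chk l (R + batch (G q)) (P3Mv (S - {q})), G(q := G q - batch (G q)), R + batch (G q))"
| p3_mv_end: "alg_step l (P3Mv {}, G, R) (P3S2 {q. alive_group l (G q) R}, G, R)"
| p3_s2_pick: "q \<in> A \<Longrightarrow> alg_step l (P3S2 A, G, R) (P3Loop q (A - {q}), G, R)"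
| p3_s2_end: "alg_step l (P3S2 {}, G, R) (P3S1 (pillars R) {}, G, R)"
| p3_loop_end: "\<not> alive_group l (G q) R \<Longrightarrow>
    alg_step l (P3Loop q A, G, R) (P3S2 A, G, R)"
| p3_loop_fat: "alive_group l (G q) R \<Longrightarrow> fat l (G q) \<Longrightarrow> t \<in># G q \<Longrightarrow> snd t \<notin> pillars R \<Longrightarrow>
    alg_step l (P3Loop q A, G, R)
      (chk l (R + {#t#}) (P3Loop q A), G(q := G q - {#t#}), R + {#t#})"
| p3_loop_thin: "alive_group l (G q) R \<Longrightarrow> thin l (G q) \<Longrightarrow> \<not> conflicting (G q) R \<Longrightarrow>
    alg_step l (P3Loop q A, G, R)
      (chk l (R + batch (G q)) (P3Loop q A), G(q := G q - batch (G q)), R + batch (G q))"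

end

theory Submission
  imports Defs
begin

text \<open>Let \<open>r = OPT div l\<close>. Phase One only removes tuples that every feasible solution also
  removes, so afterwards \<open>l * hmax R \<le> OPT\<close>, i.e. \<open>hmax R \<le> r\<close>. As long as \<open>R\<close> is not eligible
  it has fewer than \<open>l\<close> pillars, while a fat group has more than \<open>l\<close> distinct values; hence
  Phase Two and step 2 of Phase Three never increase \<open>hmax R\<close>. In step 1 of a Phase Three round
  every pillar of \<open>R\<close> is avoided by some group of \<open>S\<close> and \<open>card S < l\<close>, so \<open>hmax R\<close> grows by at
  most \<open>card S - 1 \<le> l - 2\<close>, while the sum of all \<open>hmax (G q)\<close> drops by at least \<open>card S\<close>.
  Between rounds all groups are thin, so the gap \<open>l * hmax R - size R\<close> shrinks by at least \<open>l\<close>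
  per round. It starts below \<open>l * r\<close>, so there are at most \<open>r\<close> rounds
  and \<open>hmax R \<le> r * (l - 1)\<close> throughout; the last move adds at most \<open>l\<close> tuples.\<close>

section \<open>Counts of SA values, their maximum and pillars\<close>

lemma hcnt_empty [simp]: "hcnt {#} v = 0"
  by (simp add: hcnt_def)

lemma hcnt_add [simp]: "hcnt (A + B) v = hcnt A v + hcnt B v"
  by (simp add: hcnt_def)

lemma hcnt_mono: "A \<subseteq># B \<Longrightarrow> hcnt A v \<le> hcnt B v"
  unfolding hcnt_def by (intro mset_subset_eq_count image_mset_subseteq_mono)

lemma hcnt_diff: "B \<subseteq># A \<Longrightarrow> hcnt (A - B) v = hcnt A v - hcnt B v"
  by (simp add: hcnt_def image_mset_Diff)

lemma hcnt_single: "hcnt {#t#} v = (if snd t = v then 1 else 0)"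
  by (simp add: hcnt_def)

lemma hcnt_pos_iff: "0 < hcnt Q v \<longleftrightarrow> v \<in> snd ` set_mset Q"
  by (simp add: hcnt_def count_greater_zero_iff del: count_image_mset)

lemma hcnt_sum: "finite F \<Longrightarrow> hcnt (\<Sum>q\<in>F. G q) v = (\<Sum>q\<in>F. hcnt (G q) v)"
  by (induction F rule: finite_induct) auto

lemma hcnt_le_hmax: "hcnt Q v \<le> hmax Q"
proof (cases "0 < hcnt Q v")
  case True
  then have "v \<in> set_mset (image_mset snd Q)" by (simp add: hcnt_pos_iff)
  then show ?thesis unfolding hmax_def by (intro Max_ge) auto
qed auto

lemma hmax_le: "(\<And>v. hcnt Q v \<le> b) \<Longrightarrow> hmax Q \<le> b"
  unfolding hmax_def by (subst Max_le_iff) auto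

lemma hmax_mono: "A \<subseteq># B \<Longrightarrow> hmax A \<le> hmax B"
  by (meson hmax_le hcnt_mono hcnt_le_hmax order_trans)

lemma hmax_empty [simp]: "hmax {#} = 0"
  by (simp add: hmax_def)

lemma hmax_pos: "Q \<noteq> {#} \<Longrightarrow> 0 < hmax Q"
proof -
  assume "Q \<noteq> {#}"
  then obtain t where "t \<in># Q" by auto
  then have "0 < hcnt Q (snd t)" by (simp add: hcnt_pos_iff)
  then show ?thesis using hcnt_le_hmax[of Q "snd t"] by linarith
qed

lemma pillar_exists:
  assumes "Q \<noteq> {#}"
  obtains v where "v \<in> pillars Q"
proof -
  have "hmax Q \<in> insert 0 (hcnt Q ` set_mset (image_mset snd Q))"
    unfolding hmax_def by (rule Max_in) auto
  with hmax_pos[OF assms] obtain v where "v \<in># image_mset snd Q" "hcnt Q v = hmax Q"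
    by (metis imageE insert_iff less_irrefl)
  then show ?thesis using that unfolding pillars_def by blast
qed

lemma pillars_iff: "v \<in> pillars Q \<longleftrightarrow> Q \<noteq> {#} \<and> hcnt Q v = hmax Q"
proof
  assume "Q \<noteq> {#} \<and> hcnt Q v = hmax Q"
  then have "0 < hcnt Q v" using hmax_pos by metis
  then have "v \<in> snd ` set_mset Q" by (simp only: hcnt_pos_iff)
  then show "v \<in> pillars Q"
    using \<open>Q \<noteq> {#} \<and> _\<close> by (simp add: pillars_def)
qed (auto simp: pillars_def)

lemma hcnt_less_hmax: "Q \<noteq> {#} \<Longrightarrow> v \<notin> pillars Q \<Longrightarrow> hcnt Q v < hmax Q"
  using hcnt_le_hmax[of Q v] by (auto simp: pillars_iff)

lemma pillars_subset: "pillars Q \<subseteq> snd ` set_mset Q"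
  by (auto simp: pillars_def)

lemma finite_pillars [simp]: "finite (pillars Q)"
  using pillars_subset finite_subset by (metis finite_imageI finite_set_mset)

lemma size_conv_hcnt: "size Q = (\<Sum>v\<in>snd ` set_mset Q. hcnt Q v)"
proof -
  have "size Q = size (image_mset snd Q)" by simp
  also have "\<dots> = (\<Sum>v\<in>snd ` set_mset Q. hcnt Q v)"
    unfolding hcnt_def by (subst size_multiset_overloaded_eq) simp
  finally show ?thesis .
qed

lemma size_le_card_hmax: "size Q \<le> card (snd ` set_mset Q) * hmax Q"
  unfolding size_conv_hcnt[of Q] using sum_bounded_above[of "snd ` set_mset Q" "hcnt Q" "hmax Q"]
  by (simp add: hcnt_le_hmax)

lemma card_pillars_hmax: "card (pillars Q) * hmax Q \<le> size Q"
proof -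
  have "card (pillars Q) * hmax Q = (\<Sum>v\<in>pillars Q. hcnt Q v)"
    by (simp add: pillars_iff)
  also have "\<dots> \<le> size Q"
    unfolding size_conv_hcnt[of Q] by (intro sum_mono2 pillars_subset) auto
  finally show ?thesis .
qed

lemma hmax_le_size: "hmax Q \<le> size Q"
proof (cases "Q = {#}")
  case False
  then obtain v where "v \<in> pillars Q" by (rule pillar_exists)
  then have "1 \<le> card (pillars Q)" by (metis One_nat_def Suc_leI card_gt_0_iff empty_iff finite_pillars)
  then have "1 * hmax Q \<le> card (pillars Q) * hmax Q" by (rule mult_right_mono) simp
  then show ?thesis using card_pillars_hmax[of Q] by linarith
qed simp

section \<open>Eligibility, thin and fat groups\<close>

lemma l_eligible_empty [simp]: "l_eligible l {#}"
  by (simp add: l_eligible_def)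

text \<open>A multiset has at least \<open>hmax R\<close> tuples, so \<open>l \<le> 1\<close> makes
  every \<open>R\<close> eligible.\<close>

lemma not_eligible_l_ge2: "\<not> l_eligible l R \<Longrightarrow> 2 \<le> l"
  using hmax_le_size[of R] unfolding l_eligible_def
  by (cases l; cases "l - 1") auto

text \<open>Every pillar contributes \<open>hmax R\<close> tuples, so \<open>l\<close> pillars would
  already make \<open>R\<close> eligible.\<close>

lemma card_pillars_less:
  assumes "\<not> l_eligible l R" shows "card (pillars R) < l"
proof -
  have "card (pillars R) * hmax R < l * hmax R"
    using assms card_pillars_hmax[of R] unfolding l_eligible_def by linarith
  then show ?thesis by simp
qed

text \<open>The pillars together hold at most the \<open>l * hmax Q\<close> tuples of the group.
  This limits one batch to \<open>l\<close> tuples.\<close>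

lemma card_pillars_thin: "thin l Q \<Longrightarrow> Q \<noteq> {#} \<Longrightarrow> card (pillars Q) \<le> l"
  using card_pillars_hmax[of Q] hmax_pos[of Q] by (simp add: thin_def)

lemma fat_card_values:
  assumes "fat l Q" shows "l < card (snd ` set_mset Q)"
proof -
  have "l * hmax Q < card (snd ` set_mset Q) * hmax Q"
    using assms size_le_card_hmax[of Q] unfolding fat_def by linarith
  then show ?thesis by simp
qed

text \<open>\<open>Q\<close> has more values than \<open>R\<close> has pillars. Hence a fat group
  always has a tuple whose move does not raise \<open>hmax R\<close>.\<close>

lemma fat_non_pillar:
  assumes "fat l Q" "\<not> l_eligible l R"
  obtains t where "t \<in># Q" "snd t \<notin> pillars R"
proof -
  have "card (pillars R) < card (snd ` set_mset Q)"
    using fat_card_values[OF assms(1)] card_pillars_less[OF assms(2)] by simp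
  then have "\<not> snd ` set_mset Q \<subseteq> pillars R"
    using card_mono[OF finite_pillars] by (metis leD)
  then show ?thesis using that by auto
qed

lemma thin_or_fat: "l_eligible l Q \<Longrightarrow> thin l Q \<or> fat l Q"
  by (auto simp: l_eligible_def thin_def fat_def)

lemma not_alive_thin: "\<not> alive_group l Q R \<Longrightarrow> thin l Q"
  by (auto simp: alive_group_def dead_def thin_def)

lemma alive_thin_not_conflicting:
  "alive_group l Q R \<Longrightarrow> thin l Q \<Longrightarrow> \<not> conflicting Q R"
  by (auto simp: alive_group_def dead_def)

section \<open>Moves out of a group\<close>

lemma batch_subset: "batch Q \<subseteq># Q"
  unfolding batch_def
  by (rule mset_subset_eqI) (auto simp: count_mset_set' Suc_le_eq)

text \<open>Inside one class the SA value determines the tuple, so the distinct tuples collected by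
  \<open>batch\<close> are exactly one per pillar.\<close>

lemma hcnt_batch:
  assumes "\<And>t. t \<in># Q \<Longrightarrow> fst t = q"
  shows "hcnt (batch Q) v = (if v \<in> pillars Q then 1 else 0)"
proof -
  let ?S = "{t. t \<in># Q \<and> snd t \<in> pillars Q}"
  have "inj_on snd ?S" by (rule inj_onI) (metis assms mem_Collect_eq prod.expand)
  then have "image_mset snd (batch Q) = mset_set (snd ` ?S)"
    unfolding batch_def by (rule image_mset_mset_set)
  also have "snd ` ?S = pillars Q" using pillars_subset[of Q] by force
  finally show ?thesis by (simp add: hcnt_def)
qed

lemma size_batch:
  assumes "\<And>t. t \<in># Q \<Longrightarrow> fst t = q"
  shows "size (batch Q) = card (pillars Q)"
proof -
  let ?S = "{t. t \<in># Q \<and> snd t \<in> pillars Q}"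
  have "inj_on snd ?S" by (rule inj_onI) (metis assms mem_Collect_eq prod.expand)
  then have "card (snd ` ?S) = card ?S" by (rule card_image)
  moreover have "snd ` ?S = pillars Q" using pillars_subset[of Q] by force
  ultimately show ?thesis by (simp add: batch_def)
qed

lemma hmax_diff_batch:
  assumes "\<And>t. t \<in># Q \<Longrightarrow> fst t = q" and "Q \<noteq> {#}"
  shows "hmax (Q - batch Q) + 1 \<le> hmax Q"
proof -
  have "hmax (Q - batch Q) \<le> hmax Q - 1"
  proof (rule hmax_le)
    fix v
    show "hcnt (Q - batch Q) v \<le> hmax Q - 1"
      using hcnt_less_hmax[OF assms(2), of v]
      by (auto simp: hcnt_diff[OF batch_subset] hcnt_batch[OF assms(1)] pillars_iff)
  qed
  with hmax_pos[OF assms(2)] show ?thesis by simp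
qed

lemma batch_ne:
  assumes "Q \<noteq> {#}" shows "batch Q \<noteq> {#}"
proof -
  obtain v where v: "v \<in> pillars Q" using assms by (rule pillar_exists)
  then obtain t where "t \<in># Q" "snd t = v" using pillars_subset[of Q] by auto
  then have "t \<in> {t. t \<in># Q \<and> snd t \<in> pillars Q}" using v by auto
  moreover have "finite {t. t \<in># Q \<and> snd t \<in> pillars Q}" by simp
  ultimately show ?thesis unfolding batch_def by (metis elem_mset_set empty_iff set_mset_empty)
qed

text \<open>The batch takes at most \<open>l\<close> tuples, while the drop of \<open>hmax Q\<close>
  by at least one lowers the required size by at least \<open>l\<close>.\<close>

lemma eligible_diff_batch:
  assumes fst: "\<And>t. t \<in># Q \<Longrightarrow> fst t = q" and ne: "Q \<noteq> {#}" and "thin l Q"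
  shows "l_eligible l (Q - batch Q)"
proof -
  have "l * (hmax (Q - batch Q) + 1) \<le> l * hmax Q"
    by (rule mult_left_mono[OF hmax_diff_batch[OF fst ne]]) auto
  moreover have "size (Q - batch Q) = size Q - card (pillars Q)"
    by (simp add: size_Diff_submset batch_subset size_batch[OF fst])
  ultimately show ?thesis
    using card_pillars_thin[OF assms(3,2)] assms(3) by (simp add: l_eligible_def thin_def)
qed

lemma eligible_diff_single:
  assumes "fat l Q" "t \<in># Q"
  shows "l_eligible l (Q - {#t#})"
proof -
  have "l * hmax (Q - {#t#}) \<le> l * hmax Q" by (intro mult_left_mono hmax_mono) auto
  moreover have "size (Q - {#t#}) + 1 = size Q"
    using assms(2) by (metis Suc_eq_plus1 size_Suc_Diff1)
  ultimately show ?thesis using assms(1) unfolding l_eligible_def fat_def by linarith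
qed

section \<open>Moves into the residue\<close>

text \<open>A non-pillar is at least one below the maximum, so one more copy of it cannot exceed
  \<open>hmax R\<close>.\<close>

lemma hmax_add_le:
  assumes "R \<noteq> {#}" and "\<And>v. hcnt M v \<le> (if v \<in> pillars R then 0 else 1)"
  shows "hmax (R + M) = hmax R"
proof (rule antisym)
  show "hmax (R + M) \<le> hmax R"
  proof (rule hmax_le)
    fix v
    show "hcnt (R + M) v \<le> hmax R"
      using assms(2)[of v] hcnt_less_hmax[OF assms(1), of v] hcnt_le_hmax[of R v]
      by (auto split: if_splits)
  qed
qed (simp add: hmax_mono)

lemma hmax_add_batch:
  assumes "\<And>t. t \<in># Q \<Longrightarrow> fst t = q" "R \<noteq> {#}" "\<not> conflicting Q R"
  shows "hmax (R + batch Q) = hmax R"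
  using assms(3) by (intro hmax_add_le assms(2))
    (auto simp: hcnt_batch[OF assms(1)] conflicting_def cpill_def)

lemma hmax_add_single:
  assumes "R \<noteq> {#}" "snd t \<notin> pillars R"
  shows "hmax (R + {#t#}) = hmax R"
  using assms by (intro hmax_add_le) (auto simp: hcnt_single)

lemma pillars_grow:
  assumes "R \<noteq> {#}" "hmax (R + M) = hmax R"
  shows "pillars R \<subseteq> pillars (R + M)"
proof
  fix v assume "v \<in> pillars R"
  then show "v \<in> pillars (R + M)"
    using assms hcnt_le_hmax[of "R + M" v] by (auto simp: pillars_iff)
qed

text \<open>As long as \<open>hmax R\<close> is unchanged, \<open>R\<close> only gains pillars and
  conflicts persist. Untouched dead groups therefore never revive within step 2 of Phase
  Three.\<close>

lemma not_alive_grow: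
  assumes "R \<noteq> {#}" "hmax (R + M) = hmax R" "\<not> alive_group l Q R"
  shows "\<not> alive_group l Q (R + M)"
  using pillars_grow[OF assms(1,2)] assms(3)
  by (auto simp: alive_group_def dead_def conflicting_def cpill_def)

section \<open>The table as groups plus residue\<close>

definition hsum :: "('q \<times> 'v) multiset \<Rightarrow> ('q \<Rightarrow> ('q \<times> 'v) multiset) \<Rightarrow> nat" where
  "hsum T G = (\<Sum>q\<in>fst ` set_mset T. hmax (G q))"

text \<open>Stated with a sum instead of the truncated difference in \<open>feasible\<close>, so
  that sizes and counts simply add up.\<close>

definition splits_table ::
    "('q \<times> 'v) multiset \<Rightarrow> ('q \<Rightarrow> ('q \<times> 'v) multiset) \<Rightarrow> ('q \<times> 'v) multiset \<Rightarrow> bool" where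
  "splits_table T G R \<longleftrightarrow> (\<forall>q. G q \<subseteq># cls T q) \<and> (\<Sum>q\<in>fst ` set_mset T. G q) + R = T"

lemma size_multiset_sum: "size (\<Sum>q\<in>F. G q) = (\<Sum>q\<in>F. size (G q :: 'a multiset))"
  by (induction F rule: infinite_finite_induct) auto

lemma splits_tableD:
  assumes "splits_table T G R"
  shows splits_fst: "t \<in># G q \<Longrightarrow> fst t = q"
    and splits_ne: "G q \<noteq> {#} \<Longrightarrow> q \<in> fst ` set_mset T"
    and splits_size: "size T = size R + (\<Sum>q\<in>fst ` set_mset T. size (G q))"
    and splits_hcnt: "hcnt T v = hcnt R v + (\<Sum>q\<in>fst ` set_mset T. hcnt (G q) v)"
proof -
  have sub: "G q \<subseteq># cls T q" for q using assms by (simp add: splits_table_def)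
  have T: "T = (\<Sum>q\<in>fst ` set_mset T. G q) + R" using assms by (simp add: splits_table_def)
  show *: "fst t = q" if "t \<in># G q" for t q
    using mset_subset_eqD[OF sub that] by (simp add: cls_def)
  show "q \<in> fst ` set_mset T" if "G q \<noteq> {#}"
  proof -
    obtain t where t: "t \<in># G q" using \<open>G q \<noteq> {#}\<close> by auto
    then have "t \<in># T" using mset_subset_eqD[OF sub t] by (simp add: cls_def)
    then show ?thesis using *[OF t] by force
  qed
  have "size T = size (\<Sum>q\<in>fst ` set_mset T. G q) + size R" by (subst T) (simp only: size_union)
  then show "size T = size R + (\<Sum>q\<in>fst ` set_mset T. size (G q))" by (simp add: size_multiset_sum)
  have "hcnt T v = hcnt (\<Sum>q\<in>fst ` set_mset T. G q) v + hcnt R v" by (subst T) (simp only: hcnt_add)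
  then show "hcnt T v = hcnt R v + (\<Sum>q\<in>fst ` set_mset T. hcnt (G q) v)" by (simp add: hcnt_sum)
qed

lemma sum_fun_upd:
  assumes "finite F" "q \<in> F"
  shows "(\<Sum>x\<in>F. f ((G(q := y)) x)) = f y + (\<Sum>x\<in>F - {q}. f (G x))"
  using assms by (subst sum.remove[of F q]) (auto intro!: sum.cong)

lemma splits_move:
  assumes "splits_table T G R" "M \<subseteq># G q"
  shows "splits_table T (G(q := G q - M)) (R + M)"
proof (cases "G q = {#}")
  case True
  then show ?thesis using assms by (simp add: fun_upd_idem)
next
  case False
  then have q: "q \<in> fst ` set_mset T" using splits_ne[OF assms(1)] by blast
  let ?F = "fst ` set_mset T" and ?G = "G(q := G q - M)"
  have "(\<Sum>x\<in>?F. ?G x) + (R + M) = (G q - M) + (\<Sum>x\<in>?F - {q}. G x) + (R + M)"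
    using sum_fun_upd[of ?F q "\<lambda>x. x" G "G q - M"] q by simp
  also have "\<dots> = (G q - M + M) + (\<Sum>x\<in>?F - {q}. G x) + R" by (simp add: ac_simps)
  also have "\<dots> = (\<Sum>x\<in>?F. G x) + R"
    using q assms(2) by (simp add: sum.remove[of ?F q])
  finally have "(\<Sum>x\<in>?F. ?G x) + (R + M) = T" using assms(1) unfolding splits_table_def by metis
  moreover have "?G x \<subseteq># cls T x" for x
  proof -
    have "?G x \<subseteq># G x" by simp
    also have "G x \<subseteq># cls T x" using assms(1) by (simp add: splits_table_def)
    finally show ?thesis .
  qed
  ultimately show ?thesis by (simp add: splits_table_def)
qed

lemma hsum_move_le: "hsum T (G(q := G q - M)) \<le> hsum T G"
  unfolding hsum_def by (intro sum_mono) (auto intro: hmax_mono)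

lemma hsum_move_batch:
  assumes "splits_table T G R" "G q \<noteq> {#}"
  shows "hsum T (G(q := G q - batch (G q))) + 1 \<le> hsum T G"
proof -
  let ?F = "fst ` set_mset T"
  have q: "q \<in> ?F" using splits_ne[OF assms(1,2)] .
  have "hsum T (G(q := G q - batch (G q))) = hmax (G q - batch (G q)) + (\<Sum>x\<in>?F - {q}. hmax (G x))"
    unfolding hsum_def using q by (subst sum_fun_upd) auto
  moreover have "hsum T G = hmax (G q) + (\<Sum>x\<in>?F - {q}. hmax (G x))"
    unfolding hsum_def using q by (subst sum.remove[of ?F q]) auto
  ultimately show ?thesis
    using hmax_diff_batch[of "G q" q] splits_fst[OF assms(1)] assms(2) by fastforce
qed

lemma splits_cls: "splits_table T (cls T) {#}"
proof -
  have "(\<Sum>q\<in>fst ` set_mset T. cls T q) = T"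
  proof (rule multiset_eqI)
    fix t
    have "count (\<Sum>q\<in>fst ` set_mset T. cls T q) t
        = (\<Sum>q\<in>fst ` set_mset T. if q = fst t then count T t else 0)"
      by (auto simp: count_sum cls_def intro!: sum.cong)
    also have "\<dots> = count T t"
      by (simp add: sum.delta' count_eq_zero_iff) (metis imageI count_eq_zero_iff)
    finally show "count (\<Sum>q\<in>fst ` set_mset T. cls T q) t = count T t" .
  qed
  then show ?thesis by (simp add: splits_table_def)
qed

section \<open>Feasible solutions and the optimum\<close>

lemma feasible_iff:
  assumes "splits_table T G R"
  shows "feasible l T G R \<longleftrightarrow> (\<forall>q. l_eligible l (G q)) \<and> l_eligible l R"
proof -
  have "R = T - (\<Sum>q\<in>fst ` set_mset T. G q)"
    using assms unfolding splits_table_def by (metis add_diff_cancel_left')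
  then show ?thesis using assms unfolding feasible_def splits_table_def by auto
qed

lemma OPT_attained:
  assumes "l_eligible l T"
  obtains Qs R' where "feasible l T Qs R'" "size R' = OPT l T"
proof -
  \<comment> \<open>Suppressing the whole table is feasible because \<open>T\<close> is eligible, so
    the minimum ranges over a nonempty set.\<close>
  have "feasible l T (\<lambda>_. {#}) T" using assms by (simp add: feasible_def)
  then have "\<exists>k Qs R'. feasible l T Qs R' \<and> size R' = k" by blast
  then have "\<exists>Qs R'. feasible l T Qs R' \<and> size R' = OPT l T"
    unfolding OPT_def by (rule LeastI_ex)
  then show ?thesis using that by blast
qed

text \<open>Within a class all tuples with the same SA value are equal, so an eligible \<open>Q'\<close> leaves a
  copy of \<open>t\<close> to spare.\<close>

lemma phase_one_keeps:
  assumes "l_eligible l Q'" "Q' \<subseteq># Q" "\<not> l_eligible l Q" "t \<in># Q" "snd t \<in> pillars Q"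
    and fst: "\<And>t. t \<in># Q \<Longrightarrow> fst t = q"
  shows "Q' \<subseteq># Q - {#t#}"
proof -
  have hcnt_eq: "hcnt M (snd t) = count M t" if "M \<subseteq># Q" for M
  proof -
    have "filter_mset (\<lambda>x. snd x = snd t) M = filter_mset (\<lambda>x. x = t) M"
      using fst mset_subset_eqD[OF that] assms(4)
      by (intro filter_mset_cong) (auto simp: prod_eq_iff)
    moreover have "hcnt M (snd t) = size (filter_mset (\<lambda>x. snd x = snd t) M)"
      by (simp add: hcnt_def count_conv_size_mset filter_mset_image_mset)
    ultimately show ?thesis by (simp add: count_conv_size_mset)
  qed
  have "l * hcnt Q' (snd t) \<le> l * hmax Q'" by (intro mult_left_mono hcnt_le_hmax) simp
  also have "\<dots> \<le> size Q'" using assms(1) by (simp add: l_eligible_def)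
  also have "\<dots> \<le> size Q" using assms(2) by (rule size_mset_mono)
  also have "\<dots> < l * hcnt Q (snd t)"
    using assms(3,5) by (simp add: l_eligible_def pillars_iff)
  finally have "count Q' t < count Q t" using hcnt_eq assms(2) by simp
  then show ?thesis
    using assms(2) by (auto simp: subseteq_mset_def)
qed

lemma sum_subseteq_mono: "(\<And>q. A q \<subseteq># B q) \<Longrightarrow> (\<Sum>q\<in>F. A q) \<subseteq># (\<Sum>q\<in>F. B q :: 'a multiset)"
  by (induction F rule: infinite_finite_induct) (auto intro: subset_mset.add_mono)

lemma residue_lower_bound:
  assumes "splits_table T G R" "feasible l T Qs R'" "\<And>q. Qs q \<subseteq># G q"
  shows "R \<subseteq># R'"
proof -
  have "(\<Sum>q\<in>fst ` set_mset T. Qs q) \<subseteq># (\<Sum>q\<in>fst ` set_mset T. G q)"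
    by (rule sum_subseteq_mono[OF assms(3)])
  moreover have "R = T - (\<Sum>q\<in>fst ` set_mset T. G q)"
    using assms(1) unfolding splits_table_def by (metis add_diff_cancel_left')
  ultimately show ?thesis
    using assms(2) by (simp add: feasible_def subseteq_mset_def diff_le_mono2)
qed

section \<open>Arithmetic of the bound\<close>

lemma residue_size_after_last_move:
  assumes "\<not> l_eligible l R" "hmax R + r \<le> r * l" "size M \<le> l" "l * r \<le> opt"
  shows "size (R + M) \<le> l * opt"
proof -
  have "size R < l * hmax R" using assms(1) by (simp add: l_eligible_def)
  then have "0 < hmax R" by (cases "hmax R") auto
  \<comment> \<open>For \<open>r = 0\<close> the second hypothesis would force
    \<open>hmax R = 0\<close>. With \<open>1 \<le> r\<close> the last \<open>l\<close> tuples can be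
    charged to \<open>l * r\<close>.\<close>
  with assms(2) have "1 \<le> r" by (cases r) auto
  have "size (R + M) \<le> l * hmax R + l * 1"
    using \<open>size R < _\<close> assms(3) by simp
  also have "\<dots> \<le> l * hmax R + l * r" by (intro add_left_mono mult_left_mono \<open>1 \<le> r\<close>) simp
  also have "\<dots> = l * (hmax R + r)" by (simp add: algebra_simps)
  also have "\<dots> \<le> l * (r * l)" by (intro mult_left_mono assms(2)) simp
  also have "\<dots> \<le> l * opt" using assms(4) by (intro mult_left_mono) (simp_all add: mult.commute)
  finally show ?thesis .
qed

text \<open>Growth by at most \<open>l - 2\<close> per round means
  \<open>h \<le> r + k * (l - 2)\<close>, and \<open>k \<le> r\<close> turns this into
  \<open>h \<le> r * (l - 1)\<close>. Additive forms avoid truncated subtraction.\<close>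

lemma round_growth_bound:
  fixes h k r l :: nat
  assumes "h + 2 * k \<le> r + k * l" "k \<le> r" "2 \<le> l"
  shows "h + r \<le> r * l"
proof -
  obtain d where d: "r = k + d" using assms(2) le_Suc_ex by blast
  have "d * 2 \<le> d * l" using assms(3) by (intro mult_left_mono) auto
  moreover have "h + k \<le> d + k * l" using assms(1) by (simp add: d)
  ultimately show ?thesis unfolding d add_mult_distrib by linarith
qed

text \<open>After \<open>k\<close> rounds of Phase Three, \<open>h\<close> bounds \<open>hmax R\<close>; while the groups of \<open>S\<close> are being
  moved, the \<open>c\<close> remaining ones each still owe a decrease of \<open>hsum T G\<close> by one. The last conjunct
  is the bound on the gap \<open>l * hmax R - size R\<close>, rewritten with \<open>size T = size R + l * hsum T G\<close>
  so that it also makes sense while some groups are fat.\<close>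

definition budget ::
    "nat \<Rightarrow> ('q \<times> 'v) multiset \<Rightarrow> ('q \<Rightarrow> ('q \<times> 'v) multiset) \<Rightarrow> nat \<Rightarrow> nat \<Rightarrow> nat \<Rightarrow> bool" where
  "budget l T G h c k \<longleftrightarrow>
     (let r = OPT l T div l in
       h + 2 * k \<le> r + k * l \<and> k \<le> r \<and> l * (h + hsum T G + k) < l * r + size T + l * c)"

lemma budget_mono:
  assumes "budget l T G h c k" "h' \<le> h" "hsum T G' \<le> hsum T G"
  shows "budget l T G' h' c k"
proof -
  have "l * (h' + hsum T G' + k) \<le> l * (h + hsum T G + k)"
    by (intro mult_left_mono add_mono) (use assms in auto)
  then show ?thesis using assms unfolding budget_def Let_def by linarith
qed

lemma budget_hmax:
  assumes "budget l T G h c k" "2 \<le> l"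
  shows "h + OPT l T div l \<le> OPT l T div l * l"
  using assms round_growth_bound[of h k "OPT l T div l" l] by (simp add: budget_def Let_def)

lemma thin_size:
  assumes "splits_table T G R" "\<And>q. thin l (G q)"
  shows "size T = size R + l * hsum T G"
  using splits_size[OF assms(1)] assms(2) by (simp add: thin_def hsum_def sum_distrib_left)

text \<open>With all groups thin, the gap \<open>l * hmax R - size R\<close> is positive, while the
  budget keeps it below \<open>l * (r - k)\<close> for \<open>r = OPT l T div l\<close>. So another
  round is affordable.\<close>

lemma budget_strict:
  assumes "budget l T G (hmax R) 0 k" "splits_table T G R" "\<And>q. thin l (G q)" "\<not> l_eligible l R"
  shows "k < OPT l T div l"
proof -
  have "size T < l * (hmax R + hsum T G)"
    using thin_size[OF assms(2,3)] assms(4) by (simp add: l_eligible_def algebra_simps)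
  then have "l * k < l * (OPT l T div l)"
    using assms(1) unfolding budget_def Let_def add_mult_distrib2 by linarith
  then show ?thesis by simp
qed

text \<open>The bound on \<open>hmax R\<close> alone gives the gap bound only weakly; its strictness
  comes from \<open>R\<close> being nonempty.\<close>

lemma budget_init:
  assumes "splits_table T G R" "\<And>q. thin l (G q)" "\<not> l_eligible l R" "hmax R \<le> OPT l T div l"
  shows "budget l T G (hmax R) 0 0"
proof -
  have "R \<noteq> {#}" using assms(3) by auto
  moreover have "l * hmax R \<le> l * (OPT l T div l)" by (intro mult_left_mono assms(4)) simp
  ultimately show ?thesis
    using assms(4) thin_size[OF assms(1,2)]
    unfolding budget_def Let_def add_mult_distrib2 nonempty_has_size by linarith
qed

text \<open>If a pillar of \<open>R\<close> were a pillar of every (thin) group, it would be too frequent in \<open>T\<close>.\<close>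

lemma pillar_avoided:
  assumes "l_eligible l T" "splits_table T G R" "\<And>q. thin l (G q)" "\<not> l_eligible l R" "p \<in> pillars R"
  obtains q where "G q \<noteq> {#}" "p \<notin> pillars (G q)"
proof -
  have "\<exists>q. G q \<noteq> {#} \<and> p \<notin> pillars (G q)"
  proof (rule ccontr)
    assume none: "\<not> ?thesis"
    \<comment> \<open>Empty groups fit too: both sides are \<open>0\<close>.\<close>
    have "hcnt (G q) p = hmax (G q)" for q using none by (cases "G q = {#}") (auto simp: pillars_iff)
    then have "hcnt T p = hmax R + hsum T G"
      using splits_hcnt[OF assms(2), of p] assms(5) by (simp add: hsum_def pillars_iff)
    then have "size T < l * hcnt T p"
      using thin_size[OF assms(2,3)] assms(4) by (simp add: l_eligible_def algebra_simps)
    moreover have "l * hcnt T p \<le> l * hmax T" by (intro mult_left_mono hcnt_le_hmax) simp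
    ultimately show False using assms(1) unfolding l_eligible_def by linarith
  qed
  then show ?thesis using that by blast
qed

section \<open>Invariant of the control states\<close>

text \<open>Phase One keeps room for every feasible solution. In \<open>P3S1\<close>, each pillar
  already discarded from \<open>P\<close> is avoided by a group of \<open>S\<close>, and the last
  conjunct bounds \<open>card S\<close> by the number of pillars of \<open>R\<close>. In
  \<open>P3Mv\<close>, \<open>h\<close> also accounts for the batches still to come. In step 2 every
  alive group is waiting in \<open>A\<close> or being processed, so none is left once
  \<open>P3S2 {}\<close> is reached.\<close>

fun invar :: "nat \<Rightarrow> ('q \<times> 'v) multiset \<Rightarrow> ('q, 'v) phase \<Rightarrow> ('q \<Rightarrow> ('q \<times> 'v) multiset)
    \<Rightarrow> ('q \<times> 'v) multiset \<Rightarrow> bool" where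
  "invar l T P1 G R \<longleftrightarrow> (\<forall>Qs R'. feasible l T Qs R' \<longrightarrow> (\<forall>q. Qs q \<subseteq># G q))"
| "invar l T P2 G R \<longleftrightarrow> \<not> l_eligible l R \<and> hmax R \<le> OPT l T div l"
| "invar l T (P3S1 P S) G R \<longleftrightarrow> \<not> l_eligible l R \<and> (\<forall>q. \<not> alive_group l (G q) R) \<and>
     (\<exists>k. budget l T G (hmax R) 0 k) \<and> P \<subseteq> pillars R \<and> finite S \<and> (\<forall>q\<in>S. G q \<noteq> {#}) \<and>
     (\<forall>p\<in>pillars R - P. \<exists>q\<in>S. p \<notin> pillars (G q)) \<and> card S + card P \<le> card (pillars R)"
| "invar l T (P3Mv S) G R \<longleftrightarrow> \<not> l_eligible l R \<and> finite S \<and> (\<forall>q\<in>S. G q \<noteq> {#} \<and> thin l (G q)) \<and>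
     (\<exists>h k. (\<forall>v. hcnt R v + card {q\<in>S. v \<in> pillars (G q)} \<le> h) \<and> budget l T G h (card S) k)"
| "invar l T (P3S2 A) G R \<longleftrightarrow> \<not> l_eligible l R \<and> (\<exists>k. budget l T G (hmax R) 0 k) \<and>
     A \<subseteq> fst ` set_mset T \<and> (\<forall>q. alive_group l (G q) R \<longrightarrow> q \<in> A)"
| "invar l T (P3Loop q A) G R \<longleftrightarrow> \<not> l_eligible l R \<and> (\<exists>k. budget l T G (hmax R) 0 k) \<and>
     A \<subseteq> fst ` set_mset T \<and> (\<forall>q'. alive_group l (G q') R \<longrightarrow> q' \<in> insert q A)"
| "invar l T Done G R \<longleftrightarrow> l_eligible l R \<and> size R \<le> l * OPT l T"

fun state_invar :: "nat \<Rightarrow> ('q \<times> 'v) multiset \<Rightarrow> ('q, 'v) state \<Rightarrow> bool" where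
  "state_invar l T (ph, G, R) \<longleftrightarrow>
     splits_table T G R \<and> (ph \<noteq> P1 \<longrightarrow> (\<forall>q. l_eligible l (G q))) \<and> invar l T ph G R"

lemma state_invar_init: "state_invar l T (alg_init T)"
  using splits_cls by (auto simp: alg_init_def feasible_def)

lemma state_invar_chkI:
  assumes "splits_table T G R" "\<And>q. l_eligible l (G q)" "size R \<le> l * OPT l T"
    and "\<not> l_eligible l R \<Longrightarrow> invar l T ph G R"
  shows "state_invar l T (chk l R ph, G, R)"
  using assms by (auto simp: chk_def)

text \<open>The fat group offers a value that is no pillar of \<open>R\<close>. That value is alive,
  so the minimal \<open>v\<close> is at most as frequent in \<open>R\<close>.\<close>

lemma min_alive_not_pillar:
  assumes "\<not> l_eligible l R" "fat l (G q)" "alive_group l (G q) R"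
    and "\<And>w. alive_value l G R w \<Longrightarrow> hcnt R v \<le> hcnt R w"
  shows "v \<notin> pillars R"
proof -
  have "R \<noteq> {#}" using assms(1) by auto
  obtain t where t: "t \<in># G q" "snd t \<notin> pillars R" using fat_non_pillar assms(1,2) by metis
  have "0 < hcnt (G q) (snd t)" using t by (simp add: hcnt_pos_iff)
  then have "hcnt R v \<le> hcnt R (snd t)" using assms(3,4) by (auto simp: alive_value_def)
  also have "\<dots> < hmax R" using hcnt_less_hmax[OF \<open>R \<noteq> {#}\<close> t(2)] .
  finally show ?thesis by (simp add: pillars_iff)
qed

text \<open>Serves the moves of both later phases: Phase Two supplies
  \<open>hmax R \<le> OPT l T div l\<close>, Phase Three a budget, and with \<open>2 \<le> l\<close>
  either bounds \<open>hmax R\<close> as the last-move estimate requires.\<close>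

lemma residue_size_le_OPT:
  assumes "\<not> l_eligible l R" "hmax R \<le> OPT l T div l \<or> budget l T G h c k \<and> hmax R \<le> h"
    and "size M \<le> l"
  shows "size (R + M) \<le> l * OPT l T"
proof (rule residue_size_after_last_move[OF assms(1) _ assms(3)])
  have l: "2 \<le> l" using assms(1) by (rule not_eligible_l_ge2)
  show "hmax R + OPT l T div l \<le> OPT l T div l * l"
    using assms(2)
  proof
    assume "hmax R \<le> OPT l T div l"
    moreover have "OPT l T div l * 2 \<le> OPT l T div l * l" using l by (intro mult_left_mono) auto
    ultimately show ?thesis by linarith
  next
    assume "budget l T G h c k \<and> hmax R \<le> h"
    then show ?thesis using budget_hmax[OF _ l, of T G h c k] by linarith
  qed
qed simp

lemma invar_p2_move:
  assumes "state_invar l T (P2, G, R)" "M \<subseteq># G q" "l_eligible l (G q - M)"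
    and "size M \<le> l" "hmax (R + M) = hmax R"
  shows "state_invar l T (chk l (R + M) P2, G(q := G q - M), R + M)"
proof (rule state_invar_chkI)
  show "splits_table T (G(q := G q - M)) (R + M)" using assms by (simp add: splits_move)
  show "l_eligible l ((G(q := G q - M)) q')" for q' using assms(1,3) by simp
  show "size (R + M) \<le> l * OPT l T" using assms(1,4) by (intro residue_size_le_OPT) auto
  show "invar l T P2 (G(q := G q - M)) (R + M)" if "\<not> l_eligible l (R + M)"
    using that assms(1,5) by simp
qed

lemma invar_p3_loop_move:
  assumes "state_invar l T (P3Loop q A, G, R)" "M \<subseteq># G q" "l_eligible l (G q - M)"
    and "size M \<le> l" "hmax (R + M) = hmax R"
  shows "state_invar l T (chk l (R + M) (P3Loop q A), G(q := G q - M), R + M)"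
proof (rule state_invar_chkI)
  obtain k where k: "budget l T G (hmax R) 0 k" using assms(1) by auto
  have ne: "R \<noteq> {#}" using assms(1) by auto
  show "splits_table T (G(q := G q - M)) (R + M)" using assms by (simp add: splits_move)
  show "l_eligible l ((G(q := G q - M)) q')" for q' using assms(1,3) by simp
  show "size (R + M) \<le> l * OPT l T" using assms(1,4) k by (intro residue_size_le_OPT) auto
  have "budget l T (G(q := G q - M)) (hmax (R + M)) 0 k"
    using k by (rule budget_mono) (simp_all add: assms(5) hsum_move_le)
  \<comment> \<open>Only \<open>q\<close> has changed, and no other group can revive since
    \<open>hmax R\<close> is constant.\<close>
  moreover have "q' \<in> insert q A" if "alive_group l ((G(q := G q - M)) q') (R + M)" for q'
  proof (cases "q' = q")
    case False
    then have "alive_group l (G q') R" using that not_alive_grow[OF ne assms(5)] by auto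
    then show ?thesis using assms(1) by auto
  qed simp
  ultimately show "invar l T (P3Loop q A) (G(q := G q - M)) (R + M)" if "\<not> l_eligible l (R + M)"
    using that assms(1) by auto
qed

lemma invar_p3_mv:
  assumes inv: "state_invar l T (P3Mv S, G, R)" and q: "q \<in> S"
  shows "state_invar l T (chk l (R + batch (G q)) (P3Mv (S - {q})), G(q := G q - batch (G q)), R + batch (G q))"
proof (rule state_invar_chkI)
  let ?G = "G(q := G q - batch (G q))" and ?S = "S - {q}"
  obtain h k where h: "\<And>v. hcnt R v + card {q\<in>S. v \<in> pillars (G q)} \<le> h"
    and bud: "budget l T G h (card S) k" using inv by auto
  have split: "splits_table T G R" and fin: "finite S" and thin: "thin l (G q)" and ne: "G q \<noteq> {#}"
    using inv q by auto
  have fst: "fst t = q" if "t \<in># G q" for t using splits_fst[OF split that] .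
  show "splits_table T ?G (R + batch (G q))" using split by (intro splits_move batch_subset)
  show "l_eligible l (?G q')" for q' using inv eligible_diff_batch[OF fst ne thin] by simp
  have "hmax R \<le> h" using h by (intro hmax_le) (meson add_leE)
  then show "size (R + batch (G q)) \<le> l * OPT l T"
    using inv bud card_pillars_thin[OF thin ne] by (intro residue_size_le_OPT) (auto simp: size_batch[OF fst])
  \<comment> \<open>For each pillar of \<open>G q\<close>, the move shifts one unit from the number
    of waiting groups to the count in \<open>R\<close>, so the sum stays fixed.\<close>
  have "hcnt (R + batch (G q)) v + card {q'\<in>?S. v \<in> pillars (?G q')} \<le> h" for v
  proof -
    let ?D = "{q'\<in>S. v \<in> pillars (G q')}"
    have "{q'\<in>?S. v \<in> pillars (?G q')} = ?D - {q}" by auto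
    moreover have "hcnt (batch (G q)) v + card (?D - {q}) = card ?D"
    proof (cases "v \<in> pillars (G q)")
      case True
      then show ?thesis using q fin card_Suc_Diff1[of ?D q] by (simp add: hcnt_batch[OF fst])
    next
      case False
      then have "?D - {q} = ?D" by auto
      then show ?thesis using False by (simp add: hcnt_batch[OF fst])
    qed
    ultimately show ?thesis using h[of v] by simp
  qed
  \<comment> \<open>The allowance \<open>l * c\<close> loses \<open>l\<close>, paid for by the drop
    of \<open>hsum\<close> by at least one.\<close>
  moreover have "budget l T ?G h (card ?S) k"
  proof -
    have "l * (h + (hsum T ?G + 1) + k) \<le> l * (h + hsum T G + k)"
      using hsum_move_batch[of T G R q, OF split ne]
      by (intro mult_left_mono add_mono) auto
    moreover have "l * card S = l * card ?S + l"
      using card_Suc_Diff1[OF fin q] by (metis mult_Suc_right add.commute)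
    ultimately show ?thesis using bud unfolding budget_def Let_def add_mult_distrib2 by auto
  qed
  ultimately have "\<exists>h k. (\<forall>v. hcnt (R + batch (G q)) v + card {q'\<in>?S. v \<in> pillars (?G q')} \<le> h)
      \<and> budget l T ?G h (card ?S) k" by blast
  moreover have "finite ?S" "\<forall>q'\<in>?S. ?G q' \<noteq> {#} \<and> thin l (?G q')" using inv by auto
  ultimately show "invar l T (P3Mv ?S) ?G (R + batch (G q))" if "\<not> l_eligible l (R + batch (G q))"
    using that unfolding invar.simps by blast
qed

lemma invar_p3_s1_end:
  assumes inv: "state_invar l T (P3S1 {} S, G, R)"
  shows "state_invar l T (P3Mv S, G, R)" "S \<noteq> {}"
proof -
  obtain k where k: "budget l T G (hmax R) 0 k" using inv by auto
  have ne: "R \<noteq> {#}" and nel: "\<not> l_eligible l R" and fin: "finite S"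
    and na: "\<And>q. \<not> alive_group l (G q) R" and split: "splits_table T G R"
    and cov: "\<And>p. p \<in> pillars R \<Longrightarrow> \<exists>q\<in>S. p \<notin> pillars (G q)" using inv by auto
  have thin: "thin l (G q)" for q using na not_alive_thin by blast
  have kr: "k < OPT l T div l" using budget_strict[OF k split thin nel] .
  obtain p where "p \<in> pillars R" using pillar_exists[OF ne] .
  then show S: "S \<noteq> {}" using cov by blast
  have Spos: "0 < card S" using S fin by (simp add: card_gt_0_iff)
  \<comment> \<open>Here \<open>P = {}\<close>, so the invariant bounds \<open>card S\<close> by the
    number of pillars of \<open>R\<close>.\<close>
  have Sl: "card S < l" using inv card_pillars_less[OF nel] by simp
  \<comment> \<open>A pillar of \<open>R\<close> is missed by some group of \<open>S\<close> and
    gains at most \<open>card S - 1\<close>; any other value starts at least one lower and gains at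
    most \<open>card S\<close>.\<close>
  let ?h = "hmax R + card S - 1"
  have "hcnt R v + card {q\<in>S. v \<in> pillars (G q)} \<le> ?h" for v
  proof (cases "v \<in> pillars R")
    case True
    then obtain q where "q \<in> S" "v \<notin> pillars (G q)" using cov by blast
    then have "{q\<in>S. v \<in> pillars (G q)} \<subset> S" by blast
    then have "card {q\<in>S. v \<in> pillars (G q)} < card S" using fin by (rule psubset_card_mono[rotated])
    then show ?thesis using hcnt_le_hmax[of R v] by linarith
  next
    case False
    have "card {q\<in>S. v \<in> pillars (G q)} \<le> card S" using fin by (intro card_mono) auto
    then show ?thesis using hcnt_less_hmax[OF ne False] by linarith
  qed
  moreover have "budget l T G ?h (card S) (k + 1)"
  proof -
    \<comment> \<open>The rises of \<open>h\<close> by \<open>card S - 1\<close> and of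
      \<open>k\<close> by one add up to \<open>card S\<close>, exactly what the new allowance
      \<open>l * card S\<close> covers.\<close>
    have "?h + hsum T G + (k + 1) = (hmax R + hsum T G + k) + card S" using Spos by simp
    then have "l * (?h + hsum T G + (k + 1)) = l * (hmax R + hsum T G + k) + l * card S"
      by (simp only: add_mult_distrib2)
    \<comment> \<open>A round adds \<open>card S + 1\<close> on the left and \<open>l\<close> on the
      right, so \<open>card S < l\<close> suffices.\<close>
    moreover have "?h + 2 * (k + 1) \<le> OPT l T div l + (k + 1) * l"
    proof -
      have "hmax R + 2 * k \<le> OPT l T div l + k * l" using k by (simp add: budget_def Let_def)
      moreover have "(k + 1) * l = k * l + l" by simp
      moreover obtain c where "card S = Suc c" using Spos gr0_implies_Suc by blast
      ultimately show ?thesis using Sl by simp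
    qed
    ultimately show ?thesis using k kr unfolding budget_def Let_def by auto
  qed
  ultimately have "\<exists>h k. (\<forall>v. hcnt R v + card {q\<in>S. v \<in> pillars (G q)} \<le> h)
      \<and> budget l T G h (card S) k" by blast
  then show "state_invar l T (P3Mv S, G, R)" using inv thin by auto
qed

text \<open>The first round starts from Phase Two with \<open>k = 0\<close>; later rounds inherit
  the budget of step 2.\<close>

lemma invar_round_start:
  assumes "state_invar l T (P3S2 {}, G, R) \<or> state_invar l T (P2, G, R) \<and> (\<nexists>v. alive_value l G R v)"
  shows "state_invar l T (P3S1 (pillars R) {}, G, R)"
proof -
  have inv: "splits_table T G R" "\<not> l_eligible l R" using assms by auto
  have na: "\<not> alive_group l (G q) R" for q
  proof (cases "\<exists>v. alive_value l G R v")
    case True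
    then show ?thesis using assms by auto
  next
    case False
    show ?thesis
    proof
      assume a: "alive_group l (G q) R"
      then obtain t where "t \<in># G q" by (auto simp: alive_group_def)
      then have "0 < hcnt (G q) (snd t)" by (simp add: hcnt_pos_iff)
      then show False using a False by (auto simp: alive_value_def)
    qed
  qed
  then have "\<exists>k. budget l T G (hmax R) 0 k"
    using assms budget_init[OF inv(1) not_alive_thin inv(2)] by fastforce
  then show ?thesis using assms na by auto
qed

text \<open>Every \<open>p \<in> P\<close> is avoided by some nonempty group, so a minimizing choice
  strictly shrinks \<open>P\<close>. This serves both progress and deadlock freedom.\<close>

lemma p3_pick_decreases:
  assumes T: "l_eligible l T" and inv: "state_invar l T (P3S1 P S, G, R)" and "P \<noteq> {}"
  obtains q where "G q \<noteq> {#}"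
    "\<And>q'. G q' \<noteq> {#} \<Longrightarrow> card (cpill (G q) R \<inter> P) \<le> card (cpill (G q') R \<inter> P)"
    "card (cpill (G q) R \<inter> P) < card P"
proof -
  obtain p where p: "p \<in> P" "p \<in> pillars R" using assms(3) inv by auto
  have split: "splits_table T G R" "\<not> l_eligible l R"
    and na: "\<And>q. \<not> alive_group l (G q) R" using inv by auto
  have thin: "thin l (G q)" for q using na not_alive_thin by blast
  obtain q0 where q0: "G q0 \<noteq> {#}" "p \<notin> pillars (G q0)"
    using pillar_avoided[OF T split(1) thin split(2) p(2)] .
  obtain q where q: "G q \<noteq> {#}"
    "\<And>q'. G q' \<noteq> {#} \<Longrightarrow> card (cpill (G q) R \<inter> P) \<le> card (cpill (G q') R \<inter> P)"
    using ex_has_least_nat[of "\<lambda>q. G q \<noteq> {#}" q0 "\<lambda>q. card (cpill (G q) R \<inter> P)"] q0(1) by blast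
  have "cpill (G q0) R \<inter> P \<subset> P" using p(1) q0(2) by (auto simp: cpill_def)
  moreover have "finite P" using inv finite_subset[OF _ finite_pillars] by auto
  ultimately have "card (cpill (G q0) R \<inter> P) < card P" by (intro psubset_card_mono)
  then show ?thesis using that q q0(1) le_less_trans by blast
qed

lemma invar_p3_pick:
  assumes T: "l_eligible l T" and inv: "state_invar l T (P3S1 P S, G, R)" and "P \<noteq> {}"
    and q: "G q \<noteq> {#}"
    "\<And>q'. G q' \<noteq> {#} \<Longrightarrow> card (cpill (G q) R \<inter> P) \<le> card (cpill (G q') R \<inter> P)"
  shows "state_invar l T (P3S1 (P \<inter> cpill (G q) R) (insert q S), G, R)"
    "card (P \<inter> cpill (G q) R) < card P"
proof -
  obtain q1 where "card (cpill (G q1) R \<inter> P) < card P" "G q1 \<noteq> {#}"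
    using p3_pick_decreases[OF assms(1-3)] by metis
  then show less: "card (P \<inter> cpill (G q) R) < card P"
    using q(2)[of q1] by (simp add: Int_commute)
  \<comment> \<open>\<open>S\<close> gains at most one element while \<open>P\<close> loses at least
    one.\<close>
  have "card (insert q S) \<le> Suc (card S)" by (rule card_insert_le_m1) auto
  then have "card (insert q S) + card (P \<inter> cpill (G q) R) \<le> card (pillars R)"
    using less inv by simp
  moreover have "\<exists>q\<in>insert q S. p \<notin> pillars (G q)" if "p \<in> pillars R - (P \<inter> cpill (G q) R)" for p
    using that inv by (auto simp: cpill_def)
  ultimately show "state_invar l T (P3S1 (P \<inter> cpill (G q) R) (insert q S), G, R)"
    using inv q(1) by auto
qed

text \<open>The residue lies inside that of an optimal solution, which is eligible; hence
  \<open>l * hmax R\<close> is at most \<open>OPT l T\<close>.\<close>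

lemma invar_p1_end:
  assumes l: "1 \<le> l" and T: "l_eligible l T" and inv: "state_invar l T (P1, G, R)" and el: "\<And>q. l_eligible l (G q)"
  shows "state_invar l T (chk l R P2, G, R)"
proof -
  obtain Qs R' where opt: "feasible l T Qs R'" "size R' = OPT l T" using OPT_attained[OF T] .
  have split: "splits_table T G R" using inv by simp
  have "R \<subseteq># R'" using residue_lower_bound[OF split opt(1)] inv opt(1) by auto
  then have "size R \<le> OPT l T" "hmax R \<le> hmax R'"
    using opt(2) size_mset_mono hmax_mono by metis+
  have "l * hmax R \<le> l * hmax R'" by (intro mult_left_mono \<open>hmax R \<le> _\<close>) simp
  also have "\<dots> \<le> OPT l T" using opt unfolding feasible_def l_eligible_def by metis
  finally have h: "l * hmax R \<le> OPT l T" .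
  \<comment> \<open>Covers the run that stops right after Phase One.\<close>
  have "1 * OPT l T \<le> l * OPT l T" using l by (rule mult_right_mono) simp
  with \<open>size R \<le> _\<close> have "size R \<le> l * OPT l T" by linarith
  moreover have "hmax R \<le> OPT l T div l"
    using h l by (simp add: less_eq_div_iff_mult_less_eq mult.commute)
  ultimately show ?thesis using split el by (intro state_invar_chkI) auto
qed

section \<open>Preservation of the invariant\<close>

lemma step_invar:
  assumes "alg_step l s s'" "l_eligible l T" "state_invar l T s" "1 \<le> l"
  shows "state_invar l T s'"
  using assms(1,3)
proof (cases rule: alg_step.cases)
  case (p1_move G q t R)
  have split: "splits_table T G R" using assms(3) p1_move by simp
  have "Qs q' \<subseteq># (G(q := G q - {#t#})) q'" if f: "feasible l T Qs R'" for Qs R' q'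
  proof -
    have sub: "Qs q' \<subseteq># G q'" for q' using assms(3) f p1_move by auto
    have "l_eligible l (Qs q)" using f by (simp add: feasible_def)
    then have "Qs q \<subseteq># G q - {#t#}"
      using phase_one_keeps[OF _ sub] p1_move splits_fst[OF split] by metis
    then show ?thesis using sub by simp
  qed
  then show ?thesis using p1_move splits_move[OF split, of "{#t#}" q] by auto
next
  case (p1_end G R)
  then show ?thesis using invar_p1_end assms by blast
next
  case (p2_end G R)
  then show ?thesis using invar_round_start assms by blast
next
  case (p2_fat G R v q t)
  have nel: "\<not> l_eligible l R" using assms(3) p2_fat by auto
  have "v \<notin> pillars R" using min_alive_not_pillar[where G = G and q = q, OF nel] p2_fat by blast
  then have "hmax (R + {#t#}) = hmax R" using nel p2_fat by (intro hmax_add_single) auto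
  moreover have "size {#t#} \<le> l" using not_eligible_l_ge2[OF nel] by simp
  ultimately show ?thesis
    unfolding p2_fat(2)
    by (intro invar_p2_move eligible_diff_single) (use p2_fat assms(3) in auto)
next
  case (p2_thin G R v q)
  have nel: "\<not> l_eligible l R" and split: "splits_table T G R" using assms(3) p2_thin by auto
  have ne: "G q \<noteq> {#}" and nc: "\<not> conflicting (G q) R"
    using p2_thin alive_thin_not_conflicting by (auto simp: alive_group_def)
  have fst: "fst t = q" if "t \<in># G q" for t using splits_fst[OF split that] .
  have "R \<noteq> {#}" using nel by auto
  have thin: "thin l (G q)" using p2_thin by blast
  have "size (batch (G q)) \<le> l" using card_pillars_thin[OF thin ne] by (simp add: size_batch[OF fst])
  moreover have "hmax (R + batch (G q)) = hmax R" using hmax_add_batch[OF fst \<open>R \<noteq> {#}\<close> nc] .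
  ultimately show ?thesis
    unfolding p2_thin(2)
    by (intro invar_p2_move batch_subset eligible_diff_batch[OF fst ne thin]) (use p2_thin assms(3) in auto)
next
  case (p3_pick P G q R S)
  then show ?thesis using invar_p3_pick(1)[OF assms(2)] assms(3) by blast
next
  case (p3_s1_end S G R)
  then show ?thesis using invar_p3_s1_end(1) assms(3) by blast
next
  case (p3_mv q S G R)
  then show ?thesis using assms(3) by (metis invar_p3_mv)
next
  case (p3_mv_end G R)
  have split: "splits_table T G R" using assms(3) p3_mv_end by simp
  obtain h k where h: "\<And>v. hcnt R v \<le> h" and k: "budget l T G h 0 k" using assms(3) p3_mv_end by auto
  have "budget l T G (hmax R) 0 k" using k hmax_le[OF h] by (rule budget_mono) simp
  moreover have "q \<in> fst ` set_mset T" if "alive_group l (G q) R" for q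
    using that splits_ne[OF split] by (auto simp: alive_group_def)
  ultimately show ?thesis using assms(3) p3_mv_end by auto
next
  case (p3_s2_pick q A G R)
  then show ?thesis using assms(3) by auto
next
  case (p3_s2_end G R)
  then show ?thesis using invar_round_start assms(3) by blast
next
  case (p3_loop_end G q R A)
  then show ?thesis using assms(3) by auto
next
  case (p3_loop_fat G q R t A)
  have nel: "\<not> l_eligible l R" using assms(3) p3_loop_fat by auto
  then have "hmax (R + {#t#}) = hmax R" using p3_loop_fat by (intro hmax_add_single) auto
  moreover have "size {#t#} \<le> l" using not_eligible_l_ge2[OF nel] by simp
  ultimately show ?thesis
    unfolding p3_loop_fat(2)
    by (intro invar_p3_loop_move eligible_diff_single) (use p3_loop_fat assms(3) in auto)
next
  case (p3_loop_thin G q R A)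
  have nel: "\<not> l_eligible l R" and split: "splits_table T G R" using assms(3) p3_loop_thin by auto
  have ne: "G q \<noteq> {#}" using p3_loop_thin by (auto simp: alive_group_def)
  have fst: "fst t = q" if "t \<in># G q" for t using splits_fst[OF split that] .
  have "R \<noteq> {#}" using nel by auto
  have thin: "thin l (G q)" and nc: "\<not> conflicting (G q) R" using p3_loop_thin by blast+
  have "size (batch (G q)) \<le> l" using card_pillars_thin[OF thin ne] by (simp add: size_batch[OF fst])
  moreover have "hmax (R + batch (G q)) = hmax R" using hmax_add_batch[OF fst \<open>R \<noteq> {#}\<close> nc] .
  ultimately show ?thesis
    unfolding p3_loop_thin(2)
    by (intro invar_p3_loop_move batch_subset eligible_diff_batch[OF fst ne thin])
      (use p3_loop_thin assms(3) in auto)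
qed

section \<open>Absence of deadlock, and termination\<close>

text \<open>The rules for alive groups never lack a candidate: a fat group has a non-pillar tuple
  and an alive thin group is non-conflicting.\<close>

lemma stuck_done:
  assumes "l_eligible l T" "state_invar l T (ph, G, R)" "\<nexists>s'. alg_step l (ph, G, R) s'"
  shows "ph = Done"
proof (cases ph)
  case P1
  then obtain q where q: "\<not> l_eligible l (G q)" using assms(3) p1_end by metis
  then have "G q \<noteq> {#}" by auto
  then obtain v where v: "v \<in> pillars (G q)" by (rule pillar_exists)
  then obtain t where "t \<in># G q" "snd t = v" using pillars_subset[of "G q"] by auto
  then show ?thesis using assms(3) P1 p1_move[of l G q _ R] q v by blast
next
  case P2
  show ?thesis
  proof (cases "\<exists>v. alive_value l G R v")
    case True
    then obtain v where v: "alive_value l G R v" "\<forall>w. alive_value l G R w \<longrightarrow> hcnt R v \<le> hcnt R w"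
      using ex_has_least_nat[of "alive_value l G R" _ "hcnt R"] by blast
    then obtain q where q: "alive_group l (G q) R" "0 < hcnt (G q) v" by (auto simp: alive_value_def)
    then obtain t where t: "t \<in># G q" "snd t = v" by (auto simp: hcnt_pos_iff)
    have "thin l (G q) \<or> fat l (G q)" using assms(2) P2 by (intro thin_or_fat) auto
    then show ?thesis
      using assms(3) P2 p2_fat[OF v q _ t] p2_thin[OF v q] by blast
  next
    case False
    then show ?thesis using assms(3) P2 p2_end by blast
  qed
next
  case (P3S1 P S)
  show ?thesis
  proof (cases "P = {}")
    case True
    then show ?thesis using assms(3) P3S1 p3_s1_end by blast
  next
    case False
    then show ?thesis
      using p3_pick_decreases[OF assms(1), of P S G R] assms(2,3) P3S1 p3_pick[OF False] by metis
  qed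
next
  case (P3Mv S)
  then show ?thesis using assms(3) p3_mv p3_mv_end by (metis ex_in_conv)
next
  case (P3S2 A)
  then show ?thesis using assms(3) p3_s2_pick p3_s2_end by (metis ex_in_conv)
next
  case (P3Loop q A)
  have "l_eligible l (G q)" and nel: "\<not> l_eligible l R" using assms(2) P3Loop by auto
  then have el: "thin l (G q) \<or> fat l (G q)" by (intro thin_or_fat)
  consider "\<not> alive_group l (G q) R" | "alive_group l (G q) R" "fat l (G q)"
    | "alive_group l (G q) R" "thin l (G q)" using el by blast
  then show ?thesis
  proof cases
    case 1
    then show ?thesis using assms(3) P3Loop p3_loop_end[of l G q R A] by blast
  next
    case 2
    then obtain t where "t \<in># G q" "snd t \<notin> pillars R" using fat_non_pillar nel by metis
    then show ?thesis using 2 assms(3) P3Loop p3_loop_fat[of l G q R _ A] by blast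
  next
    case 3
    then show ?thesis
      using assms(3) P3Loop p3_loop_thin[of l G q R A] alive_thin_not_conflicting by blast
  qed
qed

text \<open>A round leads back to its start, so the level must sink along the cycle except at a move.
  Entering the move state with \<open>S \<noteq> {}\<close> forces a move; leaving it with \<open>S = {}\<close> happens only
  after one, whence its two levels.\<close>

fun level :: "('q, 'v) phase \<Rightarrow> nat" where
  "level P1 = 6"
| "level P2 = 5"
| "level (P3Mv S) = (if S = {} then 4 else 1)"
| "level (P3S2 A) = 3"
| "level (P3Loop q A) = 3"
| "level (P3S1 P S) = 2"
| "level Done = 0"

text \<open>The factor 2 leaves room for the loop state between waiting with \<open>A\<close> and
  waiting with \<open>A - {q}\<close>.\<close>

fun sublevel :: "('q, 'v) phase \<Rightarrow> nat" where
  "sublevel (P3S2 A) = 2 * card A"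
| "sublevel (P3Loop q A) = 2 * card A + 1"
| "sublevel (P3S1 P S) = card P"
| "sublevel _ = 0"

definition total :: "('q \<times> 'v) multiset \<Rightarrow> ('q \<Rightarrow> ('q \<times> 'v) multiset) \<Rightarrow> nat" where
  "total T G = (\<Sum>q\<in>fst ` set_mset T. size (G q))"

text \<open>An actual move lowers \<open>total\<close> whatever phase follows; only steps without a
  move rely on the other two measures.\<close>

definition progress_order :: "('q \<times> 'v) multiset \<Rightarrow> (('q, 'v) state \<times> ('q, 'v) state) set" where
  "progress_order T = measures
     [\<lambda>(ph, G, R). total T G, \<lambda>(ph, G, R). level ph, \<lambda>(ph, G, R). sublevel ph]"

lemma total_move:
  assumes "splits_table T G R" "M \<subseteq># G q" "M \<noteq> {#}"
  shows "total T (G(q := G q - M)) < total T G"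
proof -
  let ?F = "fst ` set_mset T"
  have "G q \<noteq> {#}" using assms(2,3) by auto
  then have q: "q \<in> ?F" using splits_ne[OF assms(1)] by blast
  have "size (G q - M) < size (G q)"
    using assms(2,3) size_mset_mono[OF assms(2)] by (simp add: size_Diff_submset nonempty_has_size)
  moreover have "total T (G(q := G q - M)) = size (G q - M) + (\<Sum>x\<in>?F - {q}. size (G x))"
    unfolding total_def using q by (subst sum_fun_upd) auto
  moreover have "total T G = size (G q) + (\<Sum>x\<in>?F - {q}. size (G x))"
    unfolding total_def using q by (subst sum.remove[of ?F q]) auto
  ultimately show ?thesis by simp
qed

lemma step_decreases:
  assumes "alg_step l s s'" "l_eligible l T" "state_invar l T s"
  shows "(s', s) \<in> progress_order T"
proof -
  have move: "((ph', G(q := G q - M), R'), (ph, G, R)) \<in> progress_order T"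
    if "splits_table T G R" "M \<subseteq># G q" "M \<noteq> {#}" for ph ph' :: "('a, 'b) phase" and G R R' q M
    using total_move[OF that] by (simp add: progress_order_def)
  show ?thesis
    using assms(1,3)
  proof (cases rule: alg_step.cases)
    case (p3_pick P G q R S)
    then show ?thesis
      using invar_p3_pick(2)[OF assms(2), of P S G R q] assms(3) by (simp add: progress_order_def)
  next
    case (p3_s1_end S G R)
    then have "S \<noteq> {}" using assms(3) by (metis invar_p3_s1_end(2))
    then show ?thesis using p3_s1_end by (simp add: progress_order_def)
  next
    case (p3_s2_pick q A G R)
    have "finite A" using assms(3) p3_s2_pick finite_subset by auto
    then have "card A = Suc (card (A - {q}))" using p3_s2_pick by (metis card_Suc_Diff1)
    then show ?thesis using p3_s2_pick by (simp add: progress_order_def)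
  next
    case (p1_move G q t R)
    show ?thesis unfolding p1_move(1,2) using assms(3) p1_move by (intro move) auto
  next
    case (p1_end G R)
    then show ?thesis by (simp add: progress_order_def chk_def)
  next
    case (p2_end G R)
    then show ?thesis by (simp add: progress_order_def chk_def)
  next
    case (p2_fat G R v q t)
    show ?thesis unfolding p2_fat(1,2) using assms(3) p2_fat by (intro move) auto
  next
    case (p2_thin G R v q)
    then have "G q \<noteq> {#}" using assms(3) by (auto simp: alive_group_def)
    then show ?thesis unfolding p2_thin(1,2) using assms(3) p2_thin
      by (intro move batch_subset batch_ne) auto
  next
    case (p3_mv q S G R)
    then have "G q \<noteq> {#}" using assms(3) by (auto simp: alive_group_def)
    then show ?thesis unfolding p3_mv(1,2) using assms(3) p3_mv
      by (intro move batch_subset batch_ne) auto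
  next
    case (p3_mv_end G R)
    then show ?thesis by (simp add: progress_order_def chk_def)
  next
    case (p3_s2_end G R)
    then show ?thesis by (simp add: progress_order_def chk_def)
  next
    case (p3_loop_end G q R A)
    then show ?thesis by (simp add: progress_order_def chk_def)
  next
    case (p3_loop_fat G q R t A)
    show ?thesis unfolding p3_loop_fat(1,2) using assms(3) p3_loop_fat by (intro move) auto
  next
    case (p3_loop_thin G q R A)
    then have "G q \<noteq> {#}" using assms(3) by (auto simp: alive_group_def)
    then show ?thesis unfolding p3_loop_thin(1,2) using assms(3) p3_loop_thin
      by (intro move batch_subset batch_ne) auto
  qed
qed

text \<open>Ties are resolved by the nondeterminism of \<open>alg_step\<close>, so excluding
  infinite runs and examining every stuck reachable state covers all tie-breaking.\<close>

theorem theorem3: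
  fixes T :: "('q \<times> 'v) multiset" and l :: nat
  assumes "1 \<le> l" and "l_eligible l T"
  shows "(\<nexists>f. f 0 = alg_init T \<and> (\<forall>i. alg_step l (f i) (f (Suc i)))) \<and>
         (\<forall>ph G R. (alg_step l)\<^sup>*\<^sup>* (alg_init T) (ph, G, R) \<and> (\<nexists>st'. alg_step l (ph, G, R) st')
            \<longrightarrow> ph = Done \<and> feasible l T G R \<and> size R \<le> l * OPT l T)"
proof (intro conjI allI impI)
  show "\<nexists>f. f 0 = alg_init T \<and> (\<forall>i. alg_step l (f i) (f (Suc i)))"
  proof
    assume "\<exists>f. f 0 = alg_init T \<and> (\<forall>i. alg_step l (f i) (f (Suc i)))"
    then obtain f where f: "f 0 = alg_init T" "\<And>i. alg_step l (f i) (f (Suc i))" by blast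
    have "state_invar l T (f i)" for i
    proof (induction i)
      case 0
      show ?case using state_invar_init f(1) by metis
    next
      case (Suc i)
      then show ?case using step_invar[OF f(2) assms(2) _ assms(1)] by blast
    qed
    then have "(f (Suc i), f i) \<in> progress_order T" for i
      using step_decreases[OF f(2) assms(2)] by blast
    moreover have "wf (progress_order T)" by (simp add: progress_order_def)
    ultimately show False unfolding wf_iff_no_infinite_down_chain by blast
  qed
next
  fix ph G R
  assume a: "(alg_step l)\<^sup>*\<^sup>* (alg_init T) (ph, G, R) \<and> (\<nexists>st'. alg_step l (ph, G, R) st')"
  have inv: "state_invar l T s" if "(alg_step l)\<^sup>*\<^sup>* (alg_init T) s" for s
    using that
  proof (induction rule: rtranclp_induct)
    case base
    show ?case by (rule state_invar_init)
  next
    case (step s s')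
    then show ?case using step_invar assms by blast
  qed
  have inv: "state_invar l T (ph, G, R)" using a inv by blast
  show Done: "ph = Done" using stuck_done[OF assms(2) inv] a by blast
  show "feasible l T G R" "size R \<le> l * OPT l T"
    using inv Done by (auto simp: feasible_iff)
qed

end
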